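(* Let $\lambda$ be a nonzero real number and $n,k\ge0$ integers. Then \[ \sum_{m=k}^n \sum_{l=k}^m T_\lambda(l,k)\, S_{1,\lambda}(m,l) \binom{n}{m} \left(\frac{k}{2} \right)_{n-m}=\sum_{m=k}^n S_{1,\lambda}(m,k)\, b_{n-m,\lambda}^{(k)} \binom{n}{m}. \]
   Context: All generating functions are formal power series in $t$. Let $e_\lambda^x(t)=(1+\lambda t)^{x/\lambda}$ and $\log_\lambda t=\frac{1}{\lambda}(t^\lambda-1)$. The degenerate central factorial numbers of the second kind are given by $\frac{1}{k!}\left(e_\lambda^{1/2}(t)-e_\lambda^{-1/2}(t)\right)^k=\sum_{n\ge k}T_\lambda(n,k)\frac{t^n}{n!}$. The degenerate Stirling numbers of the first kind are given by $\frac{1}{k!}(\log_\lambda(1+t))^k=\sum_{n\ge k}S_{1,\lambda}(n,k)\frac{t^n}{n!}$. The degenerate Bernoulli numbers of the second kind of order $k$ are $b^{(k)}_{n,\lambda}=b^{(k)}_{n,\lambda}(0)$, where $\left(\frac{t}{\log_\lambda(1+t)}\right)^k(1+t)^x=\sum_{n\ge0}b^{(k)}_{n,\lambda}(x)\frac{t^n}{n!}$. Here $(y)_0=1$ and $(y)_j=y(y-1)\cdots(y-j+1)$ for $j\ge1$ is the falling factorial. *)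

theory Defs
  imports "HOL-Computational_Algebra.Formal_Power_Series" Complex_Main
begin

text \<open>
  All generating functions are formal power series over the reals. The series
  \<open>fps_binomial a\<close> is $(1+t)^a = \sum_n \binom{a}{n} t^n$; the parameter \<open>lam\<close> is
  $\lambda$, which is meant to be nonzero.
\<close>

text \<open>$e_\lambda^x(t) = (1+\lambda t)^{x/\lambda}$\<close>
definition degen_exp :: "real \<Rightarrow> real \<Rightarrow> real fps" where
  "degen_exp lam x = fps_binomial (x / lam) oo (fps_const lam * fps_X)"

text \<open>$\log_\lambda(1+t) = \frac{1}{\lambda}((1+t)^\lambda - 1)$; note the shifted argument.\<close>
definition degen_log1p :: "real \<Rightarrow> real fps" where
  "degen_log1p lam = fps_const (1 / lam) * (fps_binomial lam - 1)"

text \<open>Numbers with exponential generating function $\sum_n a_n t^n/n!$ are read off as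
  $a_n = n!\,[t^n]$.\<close>

definition degen_central_fact2 :: "real \<Rightarrow> nat \<Rightarrow> nat \<Rightarrow> real" where
  "degen_central_fact2 lam n k =
     fact n * fps_nth (fps_const (1 / fact k) *
       (degen_exp lam (1/2) - degen_exp lam (-1/2)) ^ k) n"

definition degen_stirling1 :: "real \<Rightarrow> nat \<Rightarrow> nat \<Rightarrow> real" where
  "degen_stirling1 lam n k =
     fact n * fps_nth (fps_const (1 / fact k) * degen_log1p lam ^ k) n"

text \<open>For \<open>lam \<noteq> 0\<close> the division below is exact, see \<open>degen_log1p_quotient\<close>.\<close>
definition degen_bernoulli2_poly :: "real \<Rightarrow> nat \<Rightarrow> nat \<Rightarrow> real \<Rightarrow> real" where
  "degen_bernoulli2_poly lam k n x =
     fact n * fps_nth ((fps_X / degen_log1p lam) ^ k * fps_binomial x) n"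

definition degen_bernoulli2 :: "real \<Rightarrow> nat \<Rightarrow> nat \<Rightarrow> real" where
  "degen_bernoulli2 lam k n = degen_bernoulli2_poly lam k n 0"

definition falling_fact :: "real \<Rightarrow> nat \<Rightarrow> real" where
  "falling_fact y j = (\<Prod>i<j. y - real i)"

lemma degen_log1p_quotient:
  assumes "lam \<noteq> 0"
  shows "(fps_X / degen_log1p lam) * degen_log1p lam = fps_X"
proof -
  have n0: "fps_nth (degen_log1p lam) 0 = 0"
    by (simp add: degen_log1p_def)
  have n1: "fps_nth (degen_log1p lam) 1 = 1"
    using assms by (simp add: degen_log1p_def)
  have sd: "subdegree (degen_log1p lam) = 1"
    by (rule subdegreeI) (use n0 n1 in auto)
  have "degen_log1p lam dvd fps_X"
    using n1 sd by (subst fps_dvd_iff) auto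
  then show ?thesis
    by simp
qed

end

theory Submission
  imports Defs
begin

text \<open>
  Both sides are the coefficient \<open>n! [t^n] (t^k / k!)\<close>. On the left, substituting
  \<open>log\<^sub>\<lambda>(1+t)\<close> into \<open>e\<^sub>\<lambda>\<^sup>x\<close> gives \<open>(1+t)^x\<close>, and
  \<open>((1+t)^(1/2) - (1+t)^(-1/2))^k (1+t)^(k/2) = t^k\<close>. On the right, the powers of
  \<open>log\<^sub>\<lambda>(1+t)\<close> cancel.
\<close>

text \<open>The differential equation of \<open>(1 + t)^c\<close> without a quotient, so that
  \<open>oo\<close> distributes over it directly.\<close>

lemma fps_binomial_deriv_mult:
  fixes c :: "'a::field_char_0"
  shows "(1 + fps_X) * fps_deriv (fps_binomial c) = fps_const c * fps_binomial c"
proof -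
  have "fps_deriv (fps_binomial c) * (1 + fps_X) = fps_const c * fps_binomial c"
    unfolding fps_binomial_deriv by (simp add: fps_divide_unit mult.assoc inverse_mult_eq_1)
  then show ?thesis by (simp add: mult.commute)
qed

text \<open>Both sides have constant coefficient 1 and solve \<open>(1 + t) y' = a b y\<close>,
  whose solutions are determined by that coefficient.\<close>

lemma fps_binomial_compose:
  fixes a b :: "'a::field_char_0"
  shows "fps_binomial a oo (fps_binomial b - 1) = fps_binomial (a * b)"
proof -
  define G where "G = fps_binomial b - 1"
  define F where "F = fps_binomial a oo G"
  define D where "D = fps_deriv (fps_binomial a) oo G"
  have G0: "fps_nth G 0 = 0"
    by (simp add: G_def)
  have "((1 + fps_X) * fps_deriv (fps_binomial a)) oo G = (fps_const a * fps_binomial a) oo G"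
    by (simp only: fps_binomial_deriv_mult)
  \<comment> \<open>Substituting \<open>G\<close> turns the factor \<open>1 + fps_X\<close> into
    \<open>1 + G\<close>, which is \<open>fps_binomial b\<close>.\<close>
  then have D: "fps_binomial b * D = fps_const a * F"
    using G0 by (simp add: fps_compose_mult_distrib fps_compose_add_distrib D_def F_def G_def)
  have "fps_deriv F = D * fps_deriv (fps_binomial b)"
    using G0 by (simp add: F_def D_def G_def fps_compose_deriv)
  then have "(1 + fps_X) * fps_deriv F = D * ((1 + fps_X) * fps_deriv (fps_binomial b))"
    by (simp only: mult_ac)
  also have "\<dots> = fps_const b * (fps_binomial b * D)"
    unfolding fps_binomial_deriv_mult by (simp only: mult_ac)
  also have "\<dots> = fps_const (a * b) * F"
    unfolding D by (simp only: fps_const_mult[symmetric] mult_ac)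
  finally have ODE: "fps_deriv F * (1 + fps_X) = fps_const (a * b) * F"
    by (simp only: mult.commute)
  have "fps_deriv F = fps_const (a * b) * F / (1 + fps_X)"
    unfolding ODE[symmetric] by (simp add: fps_divide_unit mult.assoc inverse_mult_eq_1')
  then have "F = fps_const (fps_nth F 0) * fps_binomial (a * b)"
    by (simp only: fps_binomial_ODE_unique)
  moreover have "fps_nth F 0 = 1"
    by (simp add: F_def)
  ultimately show ?thesis
    by (simp add: F_def G_def)
qed

lemma degen_log1p_nth_0: "fps_nth (degen_log1p lam) 0 = 0"
  by (simp add: degen_log1p_def)

text \<open>The factor \<open>lam\<close> cancels the \<open>1 / lam\<close> of the logarithm,
  leaving \<open>(1 + t)^lam\<close> raised to the power \<open>x / lam\<close>.\<close>

lemma degen_exp_compose_log1p: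
  assumes "lam \<noteq> 0"
  shows "degen_exp lam x oo degen_log1p lam = fps_binomial x"
proof -
  have "degen_exp lam x oo degen_log1p lam
      = fps_binomial (x / lam) oo ((fps_const lam * fps_X) oo degen_log1p lam)"
    unfolding degen_exp_def by (rule fps_compose_assoc[symmetric]) (simp_all add: degen_log1p_nth_0)
  also have "(fps_const lam * fps_X) oo degen_log1p lam = fps_const lam * degen_log1p lam"
    by (simp add: fps_compose_mult_distrib degen_log1p_nth_0)
  also have "\<dots> = fps_binomial lam - 1"
    using assms by (simp add: degen_log1p_def flip: mult.assoc)
  finally show ?thesis
    using assms by (simp add: fps_binomial_compose)
qed

text \<open>Each of the \<open>k\<close> differences takes one factor \<open>(1 + t)^(1/2)\<close>
  and becomes \<open>(1 + t) - 1\<close>.\<close>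

lemma fps_binomial_half_diff_power:
  "(fps_binomial (1/2) - fps_binomial (-1/2)) ^ k * fps_binomial (real k / 2) = fps_X ^ k"
proof -
  have "(fps_binomial (1/2) - fps_binomial (-1/2)) * fps_binomial (1/2) = (fps_X :: real fps)"
    by (simp add: left_diff_distrib fps_binomial_1 flip: fps_binomial_add_mult)
  moreover have "fps_binomial (real k / 2) = fps_binomial (1/2) ^ k"
    by (simp add: fps_binomial_power)
  ultimately show ?thesis
    by (simp flip: power_mult_distrib)
qed

text \<open>Identifies \<open>(1 + t)^y\<close> as the exponential generating function of
  \<open>falling_fact y\<close>.\<close>

lemma falling_fact_eq: "falling_fact y j = fact j * (y gchoose j)"
  by (simp add: falling_fact_def gbinomial_prod_rev atLeast0LessThan)

lemma fps_mult_nth_from: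
  fixes f g :: "'a::{comm_monoid_add,mult_zero} fps"
  assumes "\<And>i. i < k \<Longrightarrow> fps_nth f i = 0"
  shows "fps_nth (f * g) n = (\<Sum>i=k..n. fps_nth f i * fps_nth g (n - i))"
  unfolding fps_mult_nth using assms
  by (intro sum.mono_neutral_right) auto

text \<open>Binomial convolution of exponential generating functions; starting at \<open>k\<close>
  loses nothing because \<open>f\<close> has no terms below \<open>t^k\<close>.\<close>

lemma egf_mult_nth:
  fixes f g :: "real fps"
  assumes "\<And>i. i < k \<Longrightarrow> fps_nth f i = 0"
  shows "(\<Sum>m=k..n. fact m * fps_nth f m * (fact (n - m) * fps_nth g (n - m)) * real (n choose m))
       = fact n * fps_nth (f * g) n"
proof -
  have "fps_nth (f * g) n = (\<Sum>m=k..n. fps_nth f m * fps_nth g (n - m))"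
    by (rule fps_mult_nth_from) (rule assms)
  then show ?thesis
    unfolding sum_distrib_left by (auto simp: sum_distrib_left binomial_fact intro!: sum.cong)
qed

lemma fps_power_nth_eq_0:
  fixes f :: "'a::comm_ring_1 fps"
  assumes "fps_nth f 0 = 0" "n < k"
  shows "fps_nth (f ^ k) n = 0"
  using assms startsby_zero_power_prefix by blast

text \<open>The \<open>fact l\<close> of the central factorial number cancels the
  \<open>1 / fact l\<close> of the Stirling number, which leaves the coefficient formula for
  composition. The outer series starts at \<open>t^k\<close>, so terms with \<open>l < k\<close>
  vanish.\<close>

lemma degen_compose_nth:
  "(\<Sum>l=k..m. degen_central_fact2 lam l k * degen_stirling1 lam m l)
   = fact m * fps_nth ((fps_const (1 / fact k) *
       (degen_exp lam (1/2) - degen_exp lam (-1/2)) ^ k) oo degen_log1p lam) m"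
proof -
  define A where "A = fps_const (1 / fact k) * (degen_exp lam (1/2) - degen_exp lam (-1/2)) ^ k"
  have "fps_nth A l = 0" if "l < k" for l
    using that by (simp add: A_def fps_power_nth_eq_0 degen_exp_def)
  then have "fps_nth (A oo degen_log1p lam) m
      = (\<Sum>l=k..m. fps_nth A l * fps_nth (degen_log1p lam ^ l) m)"
    unfolding fps_compose_nth by (intro sum.mono_neutral_right) auto
  then show ?thesis
    unfolding A_def[symmetric] degen_central_fact2_def degen_stirling1_def
    by (simp add: sum_distrib_left mult_ac)
qed

theorem theorem4:
  fixes lam :: real and n k :: nat
  assumes "lam \<noteq> 0"
  shows "(\<Sum>m=k..n. \<Sum>l=k..m.
            degen_central_fact2 lam l k * degen_stirling1 lam m l *
            real (n choose m) * falling_fact (real k / 2) (n - m))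
       = (\<Sum>m=k..n.
            degen_stirling1 lam m k * degen_bernoulli2 lam k (n - m) * real (n choose m))"
proof -
  define L where "L = degen_log1p lam"
  define A where "A = (fps_const (1 / fact k) *
       (degen_exp lam (1/2) - degen_exp lam (-1/2)) ^ k) oo L"
  have A: "A = fps_const (1 / fact k) * (fps_binomial (1/2) - fps_binomial (-1/2)) ^ k"
    using assms unfolding A_def L_def
    by (simp add: fps_compose_mult_distrib fps_compose_sub_distrib
        degen_log1p_nth_0 degen_exp_compose_log1p flip: fps_compose_power)
  have "(\<Sum>m=k..n. \<Sum>l=k..m.
            degen_central_fact2 lam l k * degen_stirling1 lam m l *
            real (n choose m) * falling_fact (real k / 2) (n - m))
      = (\<Sum>m=k..n. fact m * fps_nth A m *
          (fact (n - m) * fps_nth (fps_binomial (real k / 2)) (n - m)) * real (n choose m))"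
    unfolding A_def L_def degen_compose_nth[symmetric]
    by (simp add: falling_fact_eq sum_distrib_left sum_distrib_right mult_ac)
  also have "\<dots> = fact n * fps_nth (A * fps_binomial (real k / 2)) n"
    by (rule egf_mult_nth) (simp add: A fps_power_nth_eq_0)
  also have "A * fps_binomial (real k / 2) = fps_const (1 / fact k) * fps_X ^ k"
    by (simp only: A mult.assoc fps_binomial_half_diff_power)
  \<comment> \<open>The exact division \<open>fps_X = (fps_X / L) * L\<close> splits
    \<open>t^k\<close> into the Stirling and the Bernoulli generating functions.\<close>
  also have "\<dots> = fps_const (1 / fact k) * L ^ k * (fps_X / L) ^ k"
    using degen_log1p_quotient[OF assms]
    by (simp add: L_def mult_ac flip: power_mult_distrib)
  also have "fact n * fps_nth \<dots> n
      = (\<Sum>m=k..n. fact m * fps_nth (fps_const (1 / fact k) * L ^ k) m *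
          (fact (n - m) * fps_nth ((fps_X / L) ^ k) (n - m)) * real (n choose m))"
    by (rule egf_mult_nth[symmetric]) (simp add: L_def fps_power_nth_eq_0 degen_log1p_nth_0)
  \<comment> \<open>At \<open>x = 0\<close> the factor \<open>fps_binomial x\<close> in the
    Bernoulli polynomials is 1.\<close>
  also have "\<dots> = (\<Sum>m=k..n.
            degen_stirling1 lam m k * degen_bernoulli2 lam k (n - m) * real (n choose m))"
    by (simp add: degen_stirling1_def degen_bernoulli2_def degen_bernoulli2_poly_def L_def)
  finally show ?thesis .
qed

end
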